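(* Let $\mathcal{H}$ be a separable Hilbert space, let $\mathcal{M}$ and $\mathcal{N}$ be nests on $\mathcal{H}$, and let $\theta:\mathcal{M}\to\mathcal{N}$ be an order isomorphism. If $$\|\theta-\mathrm{id}\| := \sup_{M\in\mathcal{M}}\|P_{\theta(M)}-P_M\| = \gamma < 1,$$ then there is an invertible operator $S\in\mathcal{B}(\mathcal{H})$ such that $SM=\theta(M)$ for all $M\in\mathcal{M}$. If $\gamma<\frac12$, then $S$ can be chosen so that in addition $\|S-I\|\le 2\gamma$. If $\gamma\ge\frac12$, then for any $\varepsilon>0$, $S$ can be chosen so that in addition $\|S-I\|<2+\varepsilon$.
   Context: A nest on a Hilbert space $\mathcal{H}$ is a set $\mathcal{N}$ of closed subspaces of $\mathcal{H}$ which is totally ordered by inclusion, contains $\{0\}$ and $\mathcal{H}$, and is closed under arbitrary intersections and closed linear spans of subsets of $\mathcal{N}$. For a closed subspace $N$, $P_N$ denotes the orthogonal projection onto $N$. A map $\theta:\mathcal{M}\to\mathcal{N}$ between nests is an order isomorphism if it is an order-preserving bijection (order being inclusion). *)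

theory Defs
  imports "HOL-Analysis.Analysis"
begin

text \<open>
  Complex inner product spaces, with the inner product linear in its first argument. The class
  extends \<^class>\<open>real_inner\<close>: the inherited real structure is the underlying one, with
  \<open>x \<bullet> y = Re \<langle>x, y\<rangle>\<close>. As \<open>\<langle>x, x\<rangle>\<close> is real by conjugate symmetry, positive definiteness and
  \<open>\<parallel>x\<parallel> = \<surd>\<langle>x, x\<rangle>\<close> are inherited from \<^class>\<open>real_inner\<close>.
\<close>

class complex_inner = real_inner +
  fixes scaleC :: "complex \<Rightarrow> 'a \<Rightarrow> 'a" (infixr \<open>*\<^sub>C\<close> 75)
    and cinner :: "'a \<Rightarrow> 'a \<Rightarrow> complex"
  assumes scaleC_add_right: "c *\<^sub>C (x + y) = c *\<^sub>C x + c *\<^sub>C y"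
    and scaleC_add_left: "(c + d) *\<^sub>C x = c *\<^sub>C x + d *\<^sub>C x"
    and scaleC_scaleC: "c *\<^sub>C (d *\<^sub>C x) = (c * d) *\<^sub>C x"
    and scaleC_one: "1 *\<^sub>C x = x"
    and scaleR_scaleC: "r *\<^sub>R x = complex_of_real r *\<^sub>C x"
    and cinner_commute: "cinner x y = cnj (cinner y x)"
    and cinner_add_left: "cinner (x + y) z = cinner x z + cinner y z"
    and cinner_scaleC_left: "cinner (c *\<^sub>C x) y = c * cinner x y"
    and inner_eq_Re_cinner: "inner x y = Re (cinner x y)"

class complex_hilbert = complex_inner + complete_space

global_interpretation complex_vector:
  vector_space "scaleC :: complex \<Rightarrow> 'a \<Rightarrow> 'a::complex_inner"
  by unfold_locales (fact scaleC_add_right scaleC_add_left scaleC_scaleC scaleC_one)+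

definition closed_csubspace :: "'a::complex_inner set \<Rightarrow> bool"
  where "closed_csubspace N \<longleftrightarrow> complex_vector.subspace N \<and> closed N"

text \<open>
  The orthogonal projection onto \<open>N\<close>; the description is meaningful when \<open>N\<close> is a closed subspace
  of a Hilbert space.
\<close>

definition ortho_proj :: "'a::complex_inner set \<Rightarrow> 'a \<Rightarrow> 'a"
  where "ortho_proj N x = (THE y. y \<in> N \<and> (\<forall>z\<in>N. cinner (x - y) z = 0))"

definition bounded_clinear :: "('a::complex_inner \<Rightarrow> 'b::complex_inner) \<Rightarrow> bool"
  where "bounded_clinear T \<longleftrightarrow>
    Vector_Spaces.linear scaleC scaleC T \<and> (\<exists>K. \<forall>x. norm (T x) \<le> K * norm x)"

definition invertible_op :: "('a::complex_inner \<Rightarrow> 'a) \<Rightarrow> bool"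
  where "invertible_op S \<longleftrightarrow> bounded_clinear S \<and>
    (\<exists>T. bounded_clinear T \<and> T \<circ> S = id \<and> S \<circ> T = id)"

definition nest :: "'a::complex_inner set set \<Rightarrow> bool"
  where "nest \<N> \<longleftrightarrow>
    (\<forall>N\<in>\<N>. closed_csubspace N) \<and>
    (\<forall>N\<in>\<N>. \<forall>N'\<in>\<N>. N \<subseteq> N' \<or> N' \<subseteq> N) \<and>
    {0} \<in> \<N> \<and> UNIV \<in> \<N> \<and>
    (\<forall>\<S>\<subseteq>\<N>. \<Inter>\<S> \<in> \<N>) \<and>
    (\<forall>\<S>\<subseteq>\<N>. closure (complex_vector.span (\<Union>\<S>)) \<in> \<N>)"

definition nest_order_iso ::
    "('a::complex_inner set \<Rightarrow> 'a set) \<Rightarrow> 'a set set \<Rightarrow> 'a set set \<Rightarrow> bool"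
  where "nest_order_iso \<theta> \<M> \<N> \<longleftrightarrow> bij_betw \<theta> \<M> \<N> \<and> mono_on \<M> \<theta>"

text \<open>
  The quantity \<open>\<parallel>\<theta> - id\<parallel>\<close>. For nests in a Hilbert space the supremum is over a nonempty set of reals
  bounded by 1, as a difference of two orthogonal projections has norm at most 1.
\<close>

definition nest_map_dist :: "'a::complex_inner set set \<Rightarrow> ('a set \<Rightarrow> 'a set) \<Rightarrow> real"
  where "nest_map_dist \<M> \<theta> = (SUP M\<in>\<M>. onorm (\<lambda>x. ortho_proj (\<theta> M) x - ortho_proj M x))"

end

theory Submission
  imports Defs
begin

text \<open>
  The operator is \<open>S = I - A\<close>, where \<open>A\<close> has norm at most some \<open>c < 1\<close> slightly above \<open>\<gamma>\<close> and
  \<open>(I - A) M \<subseteq> \<theta>(M)\<close> for all \<open>M\<close> in the nest. For a finite subnest, \<open>A\<close> is extended from each member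
  to the next by an explicit solution of the norm-preserving completion problem of Parrott, which
  is solvable because \<open>\<parallel>(I - P\<^bsub>\<theta>(M)\<^esub>) P\<^bsub>M\<^esub>\<parallel> \<le> \<gamma>\<close>; weak operator compactness of the ball of radius \<open>c\<close>
  then gives all of the nest at once (a form of Arveson's distance formula).

  That \<open>S M\<close> is all of \<open>\<theta>(M)\<close> is automatic: \<open>P\<^bsub>M\<^esub> S\<close> is invertible on \<open>M\<close> by a Neumann series, so \<open>P\<^bsub>M\<^esub>\<close>
  already maps \<open>S M\<close> onto \<open>M\<close>, whereas \<open>P\<^bsub>M\<^esub>\<close> is injective on the larger space \<open>\<theta>(M)\<close> because
  \<open>\<parallel>P\<^bsub>\<theta>(M)\<^esub> - P\<^bsub>M\<^esub>\<parallel> < 1\<close>.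
\<close>

section \<open>Orthogonal projections and the Riesz representation\<close>

abbreviation clinear :: "('a::complex_inner \<Rightarrow> 'b::complex_inner) \<Rightarrow> bool"
  where "clinear \<equiv> Vector_Spaces.linear scaleC scaleC"

lemma clinearI:
  assumes "\<And>x y. T (x + y) = T x + T y" and "\<And>a x. T (a *\<^sub>C x) = a *\<^sub>C T x"
  shows "clinear T"
  using assms by (simp add: Vector_Spaces.linear_iff complex_vector.vector_space_axioms)

lemma clinear_add: "clinear T \<Longrightarrow> T (x + y) = T x + T y"
  and clinear_scaleC: "clinear T \<Longrightarrow> T (a *\<^sub>C x) = a *\<^sub>C T x"
  by (simp_all add: Vector_Spaces.linear_iff)

lemma clinear_imp_linear: "clinear T \<Longrightarrow> linear T"
  by (intro linearI) (simp_all add: clinear_add clinear_scaleC scaleR_scaleC)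

lemmas clinear_zero = linear_0[OF clinear_imp_linear]
  and clinear_diff = linear_diff[OF clinear_imp_linear]

lemma bounded_clinearI:
  assumes "clinear T" and "\<And>x. norm (T x) \<le> K * norm x"
  shows "bounded_clinear T"
  using assms unfolding bounded_clinear_def by blast

lemma closed_csubspaceD:
  assumes "closed_csubspace N"
  shows "closed N" "0 \<in> N" "x \<in> N \<Longrightarrow> y \<in> N \<Longrightarrow> x + y \<in> N"
    "x \<in> N \<Longrightarrow> y \<in> N \<Longrightarrow> x - y \<in> N" "x \<in> N \<Longrightarrow> a *\<^sub>C x \<in> N" "x \<in> N \<Longrightarrow> t *\<^sub>R x \<in> N"
  using assms
  by (auto simp: closed_csubspace_def complex_vector.subspace_0 complex_vector.subspace_add
      complex_vector.subspace_diff complex_vector.subspace_scale scaleR_scaleC)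

section \<open>Sesquilinearity, the norm, and the complex Cauchy-Schwarz inequality\<close>

lemma cinner_add_right: "cinner x (y + z) = cinner x y + cinner x z"
  by (metis cinner_add_left cinner_commute complex_cnj_add)

lemma cinner_scaleC_right: "cinner x (a *\<^sub>C y) = cnj a * cinner x y"
  by (metis cinner_commute cinner_scaleC_left complex_cnj_mult)

lemma cinner_zero_left [simp]: "cinner 0 x = 0"
  by (metis add_cancel_right_right cinner_add_left)

lemma cinner_zero_right [simp]: "cinner x 0 = 0"
  by (metis cinner_commute cinner_zero_left complex_cnj_zero)

lemma cinner_diff_left: "cinner (x - y) z = cinner x z - cinner y z"
  by (metis add_diff_cancel cinner_add_left diff_add_cancel)

lemma cinner_diff_right: "cinner x (y - z) = cinner x y - cinner x z"
  by (metis add_diff_cancel cinner_add_right diff_add_cancel)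

lemma cinner_eq_zero_sym: "cinner x y = 0 \<longleftrightarrow> cinner y x = 0"
  by (metis cinner_commute complex_cnj_zero)

lemma Re_cinner_self: "Re (cinner x x) = (norm x)\<^sup>2"
  by (simp add: dot_square_norm flip: inner_eq_Re_cinner)

lemma cinner_self: "cinner x x = complex_of_real ((norm x)\<^sup>2)"
proof -
  have "Im (cinner x x) = 0"
    using cinner_commute[of x x] by (metis Reals_cnj_iff complex_is_Real_iff)
  then show ?thesis
    by (simp add: complex_eq_iff Re_cinner_self)
qed

lemma cinner_self_eq_zero: "cinner x x = 0 \<longleftrightarrow> x = 0"
  by (simp add: cinner_self)

lemma norm_scaleC: "norm (a *\<^sub>C x) = cmod a * norm x"
proof -
  have "complex_of_real ((norm (a *\<^sub>C x))\<^sup>2) = complex_of_real ((cmod a * norm x)\<^sup>2)"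
    unfolding cinner_self[symmetric] cinner_scaleC_left cinner_scaleC_right
    by (simp add: cinner_self power_mult_distrib mult.assoc[symmetric] complex_norm_square
        flip: of_real_power)
  then have "(norm (a *\<^sub>C x))\<^sup>2 = (cmod a * norm x)\<^sup>2"
    using of_real_eq_iff by blast
  then show ?thesis
    by (simp add: power2_eq_iff_nonneg)
qed

text \<open>Reduces to the real Cauchy-Schwarz inequality: multiplying \<open>x\<close> by the
  conjugate of \<open>c = cinner x y\<close> turns the inner product into the real number
  \<open>(cmod c)\<^sup>2\<close>.\<close>

lemma norm_cinner_le: "cmod (cinner x y) \<le> norm x * norm y"
proof -
  define c where "c = cinner x y"
  have "(cmod c)\<^sup>2 = Re (cinner (cnj c *\<^sub>C x) y)"
    unfolding cinner_scaleC_left c_def[symmetric]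
    by (metis Re_complex_of_real complex_norm_square mult.commute of_real_power)
  also have "\<dots> \<le> norm (cnj c *\<^sub>C x) * norm y"
    unfolding inner_eq_Re_cinner[symmetric] by (rule norm_cauchy_schwarz)
  finally have "cmod c * cmod c \<le> cmod c * (norm x * norm y)"
    by (simp add: norm_scaleC power2_eq_square mult.assoc)
  then show ?thesis
    unfolding c_def[symmetric] by (cases "c = 0") auto
qed

section \<open>Nearest points, orthogonal projections, and the Riesz representation\<close>

lemma closest_point_csubspace_ex:
  fixes x :: "'a::complex_hilbert"
  assumes N: "closed_csubspace N"
  shows "\<exists>y\<in>N. \<forall>z\<in>N. norm (x - y) \<le> norm (x - z)"
proof -
  define d where "d = infdist x N"
  have ne: "N \<noteq> {}" using closed_csubspaceD(2)[OF N] by auto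
  have d_le: "d \<le> norm (x - z)" if "z \<in> N" for z
    unfolding d_def dist_norm[symmetric] by (rule infdist_le[OF that])
  have d0: "0 \<le> d" unfolding d_def by (rule infdist_nonneg)
  have "\<exists>y\<in>N. norm (x - y) < d + 1 / Suc n" for n
  proof -
    have "(INF y\<in>N. dist x y) < d + 1 / Suc n"
      using ne by (simp add: d_def infdist_notempty)
    then show ?thesis
      using ne cINF_less_iff[OF ne bdd_below_image_dist, of x] by (auto simp: dist_norm)
  qed
  then obtain y where yN: "\<And>n. y n \<in> N" and yd: "\<And>n. norm (x - y n) < d + 1 / Suc n"
    by metis
  have lim: "(\<lambda>n. norm (x - y n)) \<longlonglongrightarrow> d"
  proof (rule tendsto_sandwich[OF always_eventually always_eventually])
    show "\<forall>n. d \<le> norm (x - y n)" using d_le yN by blast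
    show "\<forall>n. norm (x - y n) \<le> d + 1 / Suc n" using yd less_imp_le by blast
    show "(\<lambda>n. d + 1 / Suc n) \<longlonglongrightarrow> d"
      using tendsto_add[OF tendsto_const LIMSEQ_inverse_real_of_nat, of d]
      by (simp add: inverse_eq_divide)
  qed auto
  \<comment> \<open>Parallelogram law: the midpoint \<open>h\<close> lies in \<open>N\<close>, hence
    at distance at least \<open>d\<close> from \<open>x\<close>, so two nearly minimizing points
    must be close to each other.\<close>
  have par: "(norm (y m - y n))\<^sup>2 \<le> 2 * (norm (x - y m))\<^sup>2 + 2 * (norm (x - y n))\<^sup>2 - 4 * d\<^sup>2" for m n
  proof -
    define h where "h = (1/2) *\<^sub>R (y m + y n)"
    have "h \<in> N"
      unfolding h_def by (intro closed_csubspaceD(6)[OF N] closed_csubspaceD(3)[OF N] yN)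
    then have "d\<^sup>2 \<le> (norm (x - h))\<^sup>2"
      using d_le d0 by (simp add: power_mono)
    moreover have "(norm (y m - y n))\<^sup>2 + 4 * (norm (x - h))\<^sup>2
        = 2 * (norm (x - y m))\<^sup>2 + 2 * (norm (x - y n))\<^sup>2"
      unfolding h_def power2_norm_eq_inner
      by (simp add: inner_diff_left inner_diff_right inner_add_left inner_add_right
          inner_commute algebra_simps)
    ultimately show ?thesis by linarith
  qed
  have "Cauchy y"
  proof (rule metric_CauchyI)
    fix e :: real assume "0 < e"
    have "(\<lambda>n. (norm (x - y n))\<^sup>2) \<longlonglongrightarrow> d\<^sup>2"
      by (intro tendsto_intros lim)
    then have "eventually (\<lambda>n. (norm (x - y n))\<^sup>2 < d\<^sup>2 + e\<^sup>2 / 4) sequentially"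
      using \<open>0 < e\<close> by (intro order_tendstoD) auto
    then obtain k where k: "\<And>n. n \<ge> k \<Longrightarrow> (norm (x - y n))\<^sup>2 < d\<^sup>2 + e\<^sup>2 / 4"
      by (auto simp: eventually_sequentially)
    have "dist (y m) (y n) < e" if "m \<ge> k" "n \<ge> k" for m n
    proof -
      have "(norm (y m - y n))\<^sup>2 < e\<^sup>2"
        using par[of m n] k[OF that(1)] k[OF that(2)] by linarith
      then show ?thesis
        using \<open>0 < e\<close> by (simp add: dist_norm power2_less_imp_less)
    qed
    then show "\<exists>k. \<forall>m\<ge>k. \<forall>n\<ge>k. dist (y m) (y n) < e" by blast
  qed
  then obtain l where l: "y \<longlonglongrightarrow> l"
    by (auto simp: Cauchy_convergent_iff convergent_def)
  have "l \<in> N"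
    using closed_sequentially[OF closed_csubspaceD(1)[OF N]] yN l by blast
  have "(\<lambda>n. norm (x - y n)) \<longlonglongrightarrow> norm (x - l)"
    by (intro tendsto_intros l)
  then have "norm (x - l) = d"
    using lim LIMSEQ_unique by blast
  with \<open>l \<in> N\<close> show ?thesis
    using d_le by auto
qed

lemma ortho_decomposition_ex:
  fixes x :: "'a::complex_hilbert"
  assumes N: "closed_csubspace N"
  shows "\<exists>y\<in>N. \<forall>z\<in>N. cinner (x - y) z = 0"
proof -
  obtain y where y: "y \<in> N" and min: "\<And>z. z \<in> N \<Longrightarrow> norm (x - y) \<le> norm (x - z)"
    using closest_point_csubspace_ex[OF N] by blast
  have re: "Re (cinner (x - y) z) = 0" if z: "z \<in> N" for z
  proof (cases "z = 0")
    case False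
    \<comment> \<open>First variation at the nearest point: this \<open>t\<close> minimizes the
      quadratic \<open>\<parallel>x - y - t z\<parallel>\<^sup>2\<close>, which would drop below its
      value at 0 unless the inner product vanishes.\<close>
    define t where "t = inner (x - y) z / (norm z)\<^sup>2"
    have "norm (x - y) \<le> norm (x - (y + t *\<^sub>R z))"
      by (intro min closed_csubspaceD(3,6)[OF N] y z)
    then have "(norm (x - y))\<^sup>2 \<le> (norm (x - y - t *\<^sub>R z))\<^sup>2"
      by (simp add: power_mono diff_diff_add)
    also have "\<dots> = (norm (x - y))\<^sup>2 - 2 * t * inner (x - y) z + t\<^sup>2 * (norm z)\<^sup>2"
      by (simp only: power2_norm_eq_inner inner_diff_left inner_diff_right inner_scaleR_left
          inner_scaleR_right) (simp add: inner_commute power2_eq_square algebra_simps)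
    also have "\<dots> = (norm (x - y))\<^sup>2 - (inner (x - y) z)\<^sup>2 / (norm z)\<^sup>2"
      using False by (simp add: t_def field_simps power2_eq_square)
    finally have "(inner (x - y) z)\<^sup>2 / (norm z)\<^sup>2 \<le> 0" by simp
    then have "inner (x - y) z = 0"
      using False by (simp add: divide_le_0_iff)
    then show ?thesis by (simp add: inner_eq_Re_cinner)
  qed simp
  \<comment> \<open>The variational argument sees only real parts; applied to
    \<open>\<i> *\<^sub>C z\<close> it also yields the imaginary part.\<close>
  have "cinner (x - y) z = 0" if z: "z \<in> N" for z
    using re[OF z] re[OF closed_csubspaceD(5)[OF N z, of \<i>]]
    by (simp add: cinner_scaleC_right complex_eq_iff)
  with y show ?thesis by blast
qed

lemma ortho_proj_unique:
  assumes N: "closed_csubspace N" and "y \<in> N" and "\<And>z. z \<in> N \<Longrightarrow> cinner (x - y) z = 0"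
  shows "ortho_proj N x = y"
  unfolding ortho_proj_def
proof (rule the_equality)
  fix y' assume y': "y' \<in> N \<and> (\<forall>z\<in>N. cinner (x - y') z = 0)"
  then have d: "y' - y \<in> N" using assms closed_csubspaceD(4)[OF N] by blast
  have "cinner (y' - y) (y' - y) = cinner (x - y) (y' - y) - cinner (x - y') (y' - y)"
    by (simp add: cinner_diff_left)
  also have "\<dots> = 0" using y' assms(3) d by simp
  finally show "y' = y" by (simp add: cinner_self_eq_zero)
qed (use assms in blast)

context
  fixes N :: "'a::complex_hilbert set"
  assumes N: "closed_csubspace N"
begin

lemma ortho_proj_mem: "ortho_proj N x \<in> N"
  and cinner_diff_ortho_proj: "z \<in> N \<Longrightarrow> cinner (x - ortho_proj N x) z = 0"
  using ortho_decomposition_ex[OF N, of x] ortho_proj_unique[OF N, of _ x] by metis+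

lemma ortho_proj_eq_self_iff: "ortho_proj N x = x \<longleftrightarrow> x \<in> N"
  using ortho_proj_mem ortho_proj_unique[OF N, of x x] by (metis cinner_zero_left diff_self)

lemma clinear_ortho_proj: "clinear (ortho_proj N)"
proof (rule clinearI)
  fix x y a
  show "ortho_proj N (x + y) = ortho_proj N x + ortho_proj N y"
    by (intro ortho_proj_unique N closed_csubspaceD(3)[OF N] ortho_proj_mem)
      (simp add: add_diff_add cinner_add_left cinner_diff_ortho_proj)
  show "ortho_proj N (a *\<^sub>C x) = a *\<^sub>C ortho_proj N x"
    by (intro ortho_proj_unique N closed_csubspaceD(5)[OF N] ortho_proj_mem)
      (simp add: cinner_scaleC_left cinner_diff_ortho_proj
        flip: complex_vector.scale_right_diff_distrib)
qed

lemma cinner_ortho_proj: "cinner (ortho_proj N x) y = cinner x (ortho_proj N y)"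
proof -
  have "cinner (x - ortho_proj N x) (ortho_proj N y) = 0"
    by (intro cinner_diff_ortho_proj ortho_proj_mem)
  moreover have "cinner (ortho_proj N x) (y - ortho_proj N y) = 0"
    using cinner_diff_ortho_proj[OF ortho_proj_mem] cinner_eq_zero_sym by blast
  ultimately show ?thesis
    by (simp add: cinner_diff_left cinner_diff_right)
qed

lemma inner_ortho_proj: "inner (ortho_proj N x) y = inner x (ortho_proj N y)"
  by (simp add: inner_eq_Re_cinner cinner_ortho_proj)

lemma norm_ortho_proj_pythagoras:
  "(norm x)\<^sup>2 = (norm (ortho_proj N x))\<^sup>2 + (norm (x - ortho_proj N x))\<^sup>2"
proof -
  have "inner (x - ortho_proj N x) (ortho_proj N x) = 0"
    by (simp add: inner_eq_Re_cinner cinner_diff_ortho_proj ortho_proj_mem)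
  then show ?thesis
    by (simp add: power2_norm_eq_inner inner_diff_left inner_diff_right inner_commute)
qed

lemma norm_ortho_proj_le: "norm (ortho_proj N x) \<le> norm x"
  using norm_ortho_proj_pythagoras[of x] by (simp add: power2_le_imp_le)

text \<open>The double orthogonal complement: testing against \<open>u = x - ortho_proj N x\<close>
  gives \<open>cinner x u = cinner u u\<close>, so \<open>u = 0\<close>. It turns membership in
  \<open>\<theta> M\<close> into equations between inner products, which survive weak
  limits.\<close>

lemma mem_if_orthogonal_to_complement:
  assumes "\<And>y. (\<And>z. z \<in> N \<Longrightarrow> cinner y z = 0) \<Longrightarrow> cinner x y = 0"
  shows "x \<in> N"
proof -
  define u where "u = x - ortho_proj N x"
  have u: "cinner u z = 0" if "z \<in> N" for z
    unfolding u_def using cinner_diff_ortho_proj that .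
  have "cinner (ortho_proj N x) u = 0"
    using u[OF ortho_proj_mem] cinner_eq_zero_sym by blast
  then have "cinner u u = cinner x u"
    by (simp add: u_def cinner_diff_left)
  also have "\<dots> = 0" using assms u by blast
  finally show ?thesis
    by (simp add: cinner_self_eq_zero u_def flip: ortho_proj_eq_self_iff)
qed

end

text \<open>A nonzero \<open>f\<close> has a closed kernel \<open>N\<close> of codimension one, so
  \<open>f\<close> is determined by its value at a vector \<open>u\<close> orthogonal to
  \<open>N\<close>; the representing vector is a multiple of \<open>u\<close>.\<close>

lemma clinear_functional_riesz:
  fixes f :: "'a::complex_hilbert \<Rightarrow> complex"
  assumes add: "\<And>x y. f (x + y) = f x + f y" and scale: "\<And>a x. f (a *\<^sub>C x) = a * f x"
    and bound: "\<And>x. cmod (f x) \<le> K * norm x"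
  shows "\<exists>a. \<forall>x. f x = cinner x a"
proof (cases "\<forall>x. f x = 0")
  case True
  then show ?thesis by (intro exI[of _ 0]) simp
next
  case False
  have bl: "bounded_linear f"
    by (rule bounded_linear_intro[where K = K])
      (simp_all add: add scale bound scaleR_scaleC mult.commute[of _ K], simp add: scaleR_conv_of_real)
  define N where "N = {x. f x = 0}"
  have "closed N"
    unfolding N_def
    by (intro closed_Collect_eq continuous_on_const linear_continuous_on bl)
  moreover have "complex_vector.subspace N"
    using bounded_linear.linear[OF bl]
    by (auto simp: N_def complex_vector.subspace_def add scale linear_0)
  ultimately have N: "closed_csubspace N" by (simp add: closed_csubspace_def)
  obtain z where z: "f z \<noteq> 0" using False by blast
  define u where "u = z - ortho_proj N z"
  have "f (ortho_proj N z) = 0" using ortho_proj_mem[OF N, of z] by (simp add: N_def)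
  then have fu: "f u \<noteq> 0"
    using z bounded_linear.linear[OF bl] by (simp add: u_def linear_diff)
  then have "u \<noteq> 0" using linear_0[OF bounded_linear.linear[OF bl]] by auto
  \<comment> \<open>The factor is conjugated because \<open>cinner\<close> is conjugate-linear in
    its second argument.\<close>
  have "f x = cinner x ((cnj (f u) / cinner u u) *\<^sub>C u)" for x
  proof -
    have "f (x - (f x / f u) *\<^sub>C u) = 0"
      using bounded_linear.linear[OF bl] fu by (simp add: linear_diff scale)
    then have "x - (f x / f u) *\<^sub>C u \<in> N" by (simp add: N_def)
    then have "cinner u (x - (f x / f u) *\<^sub>C u) = 0"
      unfolding u_def by (rule cinner_diff_ortho_proj[OF N])
    then have "cinner (x - (f x / f u) *\<^sub>C u) u = 0"
      using cinner_eq_zero_sym by blast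
    then have "cinner x u = f x / f u * cinner u u"
      by (simp add: cinner_diff_left cinner_scaleC_left)
    then show ?thesis
      using fu \<open>u \<noteq> 0\<close> by (simp add: cinner_scaleC_right cinner_self)
  qed
  then show ?thesis by blast
qed

section \<open>Completion of contractions along a chain\<close>

text \<open>\<open>R\<close> is the inverse of \<open>I - T\<close> on \<open>M\<close>, applied
  after \<open>f\<close>. Each \<open>R e\<close> is a Banach fixed point in \<open>M\<close>, and
  uniqueness of fixed points makes \<open>R\<close> linear. The contraction bound is asked on
  \<open>M\<close> only, so \<open>T\<close> may be large elsewhere.\<close>

lemma contraction_resolvent:
  fixes T :: "'a::complex_hilbert \<Rightarrow> 'a" and f :: "'b::complex_inner \<Rightarrow> 'a"
  assumes M: "closed_csubspace M" and T: "clinear T" and f: "clinear f"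
    and TM: "\<And>x. x \<in> M \<Longrightarrow> T x \<in> M" and fM: "\<And>x. f x \<in> M"
    and q: "0 \<le> q" "q < 1" and bound: "\<And>x. x \<in> M \<Longrightarrow> norm (T x) \<le> q * norm x"
  obtains R where "clinear R" "\<And>e. R e \<in> M" "\<And>e. R e = f e + T (R e)"
proof -
  have ex: "\<exists>!x. x \<in> M \<and> f e + T x = x" for e
  proof (rule Banach_fix[OF _ _ q])
    show "complete M" using closed_csubspaceD(1)[OF M] by (simp add: complete_eq_closed)
    show "M \<noteq> {}" using closed_csubspaceD(2)[OF M] by blast
    show "(\<lambda>x. f e + T x) ` M \<subseteq> M" using closed_csubspaceD(3)[OF M] TM fM by blast
    show "dist (f e + T x) (f e + T y) \<le> q * dist x y" if "x \<in> M" "y \<in> M" for x y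
      using bound[OF closed_csubspaceD(4)[OF M that]] T by (simp add: dist_norm clinear_diff)
  qed
  then obtain R where R: "\<And>e. R e \<in> M" "\<And>e. f e + T (R e) = R e" by metis
  have uniq: "R e = x" if "x \<in> M" "f e + T x = x" for e x
  proof -
    obtain w where w: "\<And>y. y \<in> M \<and> f e + T y = y \<Longrightarrow> y = w"
      by (rule ex1E[OF ex[of e]]) blast
    show ?thesis
      using w[OF conjI[OF that]] w[OF conjI[OF R]] by simp
  qed
  have "clinear R"
  proof (rule clinearI; rule uniq)
    fix x y a
    show "R x + R y \<in> M" "a *\<^sub>C R x \<in> M"
      by (intro closed_csubspaceD(3,5)[OF M] R(1))+
    have "f (x + y) + T (R x + R y) = (f x + T (R x)) + (f y + T (R y))"
      using T f by (simp add: clinear_add)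
    then show "f (x + y) + T (R x + R y) = R x + R y" by (simp add: R)
    have "f (a *\<^sub>C x) + T (a *\<^sub>C R x) = a *\<^sub>C (f x + T (R x))"
      using T f by (simp add: clinear_scaleC scaleC_add_right)
    then show "f (a *\<^sub>C x) + T (a *\<^sub>C R x) = a *\<^sub>C R x" by (simp add: R)
  qed
  with R show thesis by (intro that) auto
qed

lemma clinear_compose: "clinear S \<Longrightarrow> clinear T \<Longrightarrow> clinear (\<lambda>x. S (T x))"
  by (rule clinearI) (simp_all add: clinear_add clinear_scaleC)

lemma clinear_add_fun: "clinear S \<Longrightarrow> clinear T \<Longrightarrow> clinear (\<lambda>x. S x + T x)"
  by (rule clinearI) (simp_all add: clinear_add clinear_scaleC scaleC_add_right)

lemma clinear_diff_fun: "clinear S \<Longrightarrow> clinear T \<Longrightarrow> clinear (\<lambda>x. S x - T x)"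
  by (rule clinearI)
    (simp_all add: clinear_add clinear_scaleC complex_vector.scale_right_diff_distrib)

lemma clinear_scaleR_fun: "clinear T \<Longrightarrow> clinear (\<lambda>x. t *\<^sub>R T x)"
  by (rule clinearI)
    (simp_all add: clinear_add clinear_scaleC scaleR_add_right scaleR_scaleC scaleC_scaleC mult.commute)

lemma clinear_ident: "clinear (\<lambda>x. x)"
  by (rule clinearI) simp_all

text \<open>With \<open>Q\<close> the projection onto the complement of \<open>K\<close>, the last
  condition on \<open>B\<close> says \<open>Q (B x) = Q x\<close>: the \<open>Q\<close>-part is
  prescribed and small by \<open>near\<close>, while outside \<open>M\<close> the part in
  \<open>K\<close> is free to be chosen. Only the values of \<open>A\<close> on \<open>M\<close>
  enter. The strict gap \<open>g < c\<close> makes the equation for the saddle point uniquely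
  solvable.\<close>

lemma contraction_completion_step:
  fixes A :: "'a::complex_hilbert \<Rightarrow> 'a"
  assumes M: "closed_csubspace M" and M': "closed_csubspace M'" and K: "closed_csubspace K"
    and MM': "M \<subseteq> M'" and A: "clinear A" and g: "0 \<le> g" "g < c"
    and near: "\<And>x. x \<in> M' \<Longrightarrow> norm (x - ortho_proj K x) \<le> g * norm x"
    and A_le: "\<And>x. x \<in> M \<Longrightarrow> norm (A x) \<le> c * norm x"
    and A_K: "\<And>x. x \<in> M \<Longrightarrow> x - A x \<in> K"
  obtains B where "clinear B" "\<And>x. x \<in> M \<Longrightarrow> B x = A x"
    "\<And>x. x \<in> M' \<Longrightarrow> norm (B x) \<le> c * norm x" "\<And>x. x \<in> M' \<Longrightarrow> x - B x \<in> K"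
proof -
  define P where "P = ortho_proj M"
  define Q where "Q x = x - ortho_proj K x" for x
  have c: "0 < c" using g by linarith
  have P: "clinear P" unfolding P_def by (rule clinear_ortho_proj[OF M])
  have Q: "clinear Q"
    unfolding Q_def by (intro clinear_diff_fun clinear_ident clinear_ortho_proj K)
  have PM: "P x \<in> M" for x unfolding P_def by (rule ortho_proj_mem[OF M])
  have P_id: "P x = x" if "x \<in> M" for x
    unfolding P_def using ortho_proj_eq_self_iff[OF M] that by blast
  have Q_zero: "Q x = 0 \<longleftrightarrow> x \<in> K" for x
    unfolding Q_def using ortho_proj_eq_self_iff[OF K, of x] by auto
  have QQ: "Q (Q x) = Q x" for x
  proof -
    have "Q (ortho_proj K x) = 0" using Q_zero ortho_proj_mem[OF K] by blast
    then show ?thesis using clinear_diff[OF Q, of x "ortho_proj K x"] by (simp add: Q_def[of x])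
  qed
  have Q_sym: "inner (Q x) y = inner x (Q y)" for x y
    by (simp add: Q_def inner_diff_left inner_diff_right inner_ortho_proj[OF K])
  have Q_pyth: "(norm x)\<^sup>2 = (norm (Q x))\<^sup>2 + (norm (x - Q x))\<^sup>2" for x
    using norm_ortho_proj_pythagoras[OF K, of x] by (simp add: Q_def)
  have Q_le: "norm (Q x) \<le> g * norm x" if "x \<in> M'" for x
    unfolding Q_def by (rule near[OF that])
  have QA: "Q (A x) = Q x" if "x \<in> M" for x
    using A_K[OF that] Q by (simp add: clinear_diff flip: Q_zero)
  have P_inner: "inner (P x) y = inner x y" if "y \<in> M" for x y
    using inner_ortho_proj[OF M, of x y] P_id[OF that] by (simp add: P_def)

  text \<open>
    The value of \<open>B\<close> at \<open>e\<close> orthogonal to \<open>M\<close> comes from the saddle point of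
    \<open>\<parallel>A x + y\<parallel>\<^sup>2 - c\<^sup>2 \<parallel>x\<parallel>\<^sup>2\<close>, maximized over \<open>x \<in> M\<close> and minimized over \<open>y\<close> with \<open>Q y = Q e\<close>. The maximizer
    \<open>r\<close> solves \<open>c\<^sup>2 r = P Q (r + e)\<close>, which does not involve \<open>A\<close>.
  \<close>
  define F where "F x = (1 / c\<^sup>2) *\<^sub>R P (Q x)" for x
  have F: "clinear F"
    unfolding F_def by (intro clinear_scaleR_fun clinear_compose[OF P] Q)
  have FM: "F x \<in> M" for x
    unfolding F_def by (intro closed_csubspaceD(6)[OF M] PM)
  \<comment> \<open>As \<open>Q\<close> is a symmetric idempotent,
    \<open>inner (P (Q x)) w = inner (Q x) (Q w)\<close> for \<open>w\<close> in \<open>M\<close>;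
    \<open>near\<close> applies to both factors, whence the square of \<open>g\<close>.\<close>
  have PQ_le: "norm (P (Q x)) \<le> g\<^sup>2 * norm x" if "x \<in> M" for x
  proof -
    define w where "w = P (Q x)"
    have wM: "w \<in> M" unfolding w_def by (rule PM)
    have "norm w * norm w = inner (P (Q x)) w"
      by (simp add: w_def flip: power2_norm_eq_inner power2_eq_square)
    also have "\<dots> = inner (Q x) w" by (rule P_inner[OF wM])
    also have "\<dots> = inner (Q x) (Q w)" using Q_sym[of "Q x" w] by (simp add: QQ)
    also have "\<dots> \<le> norm (Q x) * norm (Q w)" by (rule norm_cauchy_schwarz)
    also have "\<dots> \<le> (g * norm x) * (g * norm w)"
      using that wM MM' g by (intro mult_mono Q_le) auto
    finally have "norm w * norm w \<le> norm w * (g\<^sup>2 * norm x)"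
      by (simp add: power2_eq_square mult_ac)
    then show ?thesis
      unfolding w_def[symmetric] using g by (cases "w = 0") auto
  qed
  have F_le: "norm (F x) \<le> (g\<^sup>2 / c\<^sup>2) * norm x" if "x \<in> M" for x
    using PQ_le[OF that] c by (simp add: F_def divide_right_mono)
  have q: "0 \<le> g\<^sup>2 / c\<^sup>2" "g\<^sup>2 / c\<^sup>2 < 1"
    using g c by (auto simp: power_strict_mono)
  obtain R where R: "clinear R" "\<And>e. R e \<in> M" and R_eq: "\<And>e. R e = F e + F (R e)"
    using contraction_resolvent[OF M F F FM FM q F_le] by blast
  \<comment> \<open>The stationarity equation of the maximizer \<open>r = R e\<close>, tested
    against vectors of \<open>M\<close>.\<close>
  have R_inner: "inner (Q (R e + e)) y = c\<^sup>2 * inner (R e) y" if "y \<in> M" for e y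
  proof -
    have "R e = F (R e + e)" using R_eq[of e] F by (simp add: clinear_add add.commute)
    then have "c\<^sup>2 *\<^sub>R R e = P (Q (R e + e))"
      using c by (metis F_def divide_self_if less_numeral_extra(3) scaleR_one scaleR_scaleR
          times_divide_eq_right mult.right_neutral zero_less_power)
    then show ?thesis using P_inner[OF that] by (metis inner_scaleR_left)
  qed

  \<comment> \<open>With \<open>x = P z\<close>, \<open>e = z - P z\<close> and
    \<open>r = R e\<close> this is \<open>A x + Q e - (I - Q) (A r)\<close>. The first two terms
    have \<open>Q\<close>-part \<open>Q z\<close>, and the last one changes only the part in
    \<open>K\<close>.\<close>
  define B where "B z = A (P z) + Q (z - P z)
      - (A (R (z - P z)) - Q (A (R (z - P z))))" for z
  have E: "clinear (\<lambda>z. z - P z)" by (intro clinear_diff_fun clinear_ident P)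
  have "clinear B"
    unfolding B_def
    by (intro clinear_diff_fun clinear_add_fun clinear_compose[OF A] clinear_compose[OF Q]
        clinear_compose[OF R(1)] P E)
  moreover have "B x = A x" if "x \<in> M" for x
    using A Q R(1) by (simp add: B_def P_id[OF that] clinear_zero)
  moreover have QB: "Q (B x) = Q x" for x
    using Q QA PM R(2) by (simp add: B_def clinear_add clinear_diff QQ)
  then have "x - B x \<in> K" for x
    using Q by (simp add: clinear_diff flip: Q_zero)
  moreover have "norm (B z) \<le> c * norm z" if z: "z \<in> M'" for z
  proof -
    define x where "x = P z"
    define e where "e = z - P z"
    define r where "r = R e"
    define s where "s = r + e"
    have z_eq: "z = x + e" and xM: "x \<in> M" and rM: "r \<in> M"
      by (simp_all add: x_def e_def r_def PM R)
    have xrM: "x - r \<in> M" using closed_csubspaceD(4)[OF M] xM rM by blast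
    have orth: "inner e y = 0" if "y \<in> M" for y
      unfolding e_def using P_inner[OF that, of z] by (simp add: inner_diff_left)
    have "B z = A x + Q e - (A r - Q (A r))"
      by (simp add: B_def x_def e_def r_def)
    moreover have "Q z = Q x + Q e" using clinear_add[OF Q, of x e] by (simp flip: z_eq)
    \<comment> \<open>\<open>B z\<close> and \<open>A (x - r)\<close> have the same part in
      \<open>K\<close>. Pythagoras for both vectors then expresses the norm of \<open>B z\<close>
      through that of \<open>A (x - r)\<close>, which the bound on \<open>M\<close>
      controls.\<close>
    ultimately have "B z - Q z = A (x - r) - Q (A (x - r))"
      using clinear_diff[OF A, of x r] clinear_diff[OF Q, of x r] QA[OF rM] QA[OF xrM]
      by simp
    then have "(norm (B z))\<^sup>2 = (norm (Q z))\<^sup>2 + (norm (A (x - r)))\<^sup>2 - (norm (Q (x - r)))\<^sup>2"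
      using Q_pyth[of "B z"] Q_pyth[of "A (x - r)"] by (simp add: QB QA xrM)
    also have "\<dots> \<le> (norm (Q z))\<^sup>2 + c\<^sup>2 * (norm (x - r))\<^sup>2 - (norm (Q (x - r)))\<^sup>2"
      using power_mono[OF A_le[OF xrM], of 2] by (simp add: power_mult_distrib)
    \<comment> \<open>Expansion around the saddle point via \<open>z = (x - r) + s\<close>: the
      square of \<open>Q (x - r)\<close> cancels, and \<open>R_inner\<close> evaluates the cross
      term.\<close>
    also have "(norm (Q z))\<^sup>2 = (norm (Q (x - r)))\<^sup>2 + 2 * inner (Q s) (x - r) + (norm (Q s))\<^sup>2"
    proof -
      have "Q z = Q (x - r) + Q s"
        using clinear_add[OF Q, of "x - r" s] by (simp add: z_eq s_def algebra_simps)
      moreover have "inner (Q (x - r)) (Q s) = inner (Q s) (x - r)"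
        using Q_sym[of "Q s" "x - r"] by (simp add: QQ inner_commute)
      ultimately show ?thesis
        by (simp add: power2_norm_eq_inner inner_add_left inner_add_right inner_commute)
    qed
    also have "inner (Q s) (x - r) = c\<^sup>2 * inner r (x - r)"
      unfolding s_def r_def by (rule R_inner) (fact xrM[unfolded r_def])
    also have "(norm (Q s))\<^sup>2 \<le> c\<^sup>2 * (norm s)\<^sup>2"
    proof -
      have "s \<in> M'"
        unfolding s_def e_def using closed_csubspaceD(3,4)[OF M'] z rM PM MM' by blast
      then have "norm (Q s) \<le> c * norm s"
        using Q_le[of s] g mult_right_mono[of g c "norm s"] by simp
      from power_mono[OF this, of 2] show ?thesis by (simp add: power_mult_distrib)
    qed
    finally have "(norm (B z))\<^sup>2 \<le> c\<^sup>2 * ((norm (x - r))\<^sup>2 + 2 * inner r (x - r) + (norm s)\<^sup>2)"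
      by (simp add: algebra_simps)
    \<comment> \<open>Since \<open>e\<close> is orthogonal to \<open>x\<close> and \<open>r\<close>,
      all terms in \<open>r\<close> cancel and both sides equal
      \<open>\<parallel>x\<parallel>\<^sup>2 + \<parallel>e\<parallel>\<^sup>2\<close>.\<close>
    also have "(norm (x - r))\<^sup>2 + 2 * inner r (x - r) + (norm s)\<^sup>2 = (norm z)\<^sup>2"
      using orth[OF xM] orth[OF rM]
      by (simp add: z_eq s_def power2_norm_eq_inner inner_add_left inner_add_right
          inner_diff_left inner_diff_right inner_commute)
    finally have "(norm (B z))\<^sup>2 \<le> (c * norm z)\<^sup>2" by (simp add: power_mult_distrib)
    then show ?thesis
      using c by (meson power2_le_imp_le mult_nonneg_nonneg norm_ge_zero less_imp_le)
  qed
  ultimately show thesis by (intro that[of B]) auto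
qed

section \<open>Completion along finite chains, then along the whole nest\<close>

lemma finite_subset_chain_Union_mem:
  assumes "finite F" "F \<noteq> {}" "\<And>X Y. X \<in> F \<Longrightarrow> Y \<in> F \<Longrightarrow> X \<subseteq> Y \<or> Y \<subseteq> X"
  shows "\<Union>F \<in> F"
  using assms
proof (induction F rule: finite_ne_induct)
  case (insert X F)
  then have "\<Union>F \<in> F" by blast
  with insert.prems have "X \<subseteq> \<Union>F \<or> \<Union>F \<subseteq> X" by blast
  with \<open>\<Union>F \<in> F\<close> show ?case by (auto simp: Un_absorb1 Un_absorb2)
qed simp

context
  fixes \<M> :: "'a::complex_hilbert set set" and \<theta> :: "'a set \<Rightarrow> 'a set" and g c :: real
  assumes sub: "\<And>M. M \<in> \<M> \<Longrightarrow> closed_csubspace M" "\<And>M. M \<in> \<M> \<Longrightarrow> closed_csubspace (\<theta> M)"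
    and chain: "\<And>M N. M \<in> \<M> \<Longrightarrow> N \<in> \<M> \<Longrightarrow> M \<subseteq> N \<or> N \<subseteq> M"
    and zero: "{0} \<in> \<M>" and mono: "mono_on \<M> \<theta>"
    and g: "0 \<le> g" "g < c"
    and near: "\<And>M x. M \<in> \<M> \<Longrightarrow> x \<in> M \<Longrightarrow> norm (x - ortho_proj (\<theta> M) x) \<le> g * norm x"
begin

text \<open>Induction by removing the largest member \<open>G\<close>: an operator for the remaining
  members is extended from their union \<open>H\<close> to \<open>G\<close>.\<close>

lemma finite_chain_completion:
  assumes "finite F" "F \<subseteq> \<M>"
  shows "\<exists>A. clinear A \<and> (\<forall>M\<in>F. \<forall>x\<in>M. norm (A x) \<le> c * norm x \<and> x - A x \<in> \<theta> M)"
  using assms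
proof (induction F rule: finite_psubset_induct)
  case (psubset F)
  show ?case
  proof (cases "F = {}")
    case True
    then show ?thesis using clinear_ident by blast
  next
    case False
    define G where "G = \<Union>F"
    have F_chain: "X \<subseteq> Y \<or> Y \<subseteq> X" if "X \<in> F" "Y \<in> F" for X Y
      using chain that psubset.prems by blast
    have GF: "G \<in> F"
      unfolding G_def
      by (rule finite_subset_chain_Union_mem[OF psubset.hyps False F_chain])
    have "F - {G} \<subset> F" "F - {G} \<subseteq> \<M>"
      using psubset.prems GF by auto
    from psubset.IH[OF this] obtain A where A: "clinear A"
      and A_F: "\<And>M x. M \<in> F - {G} \<Longrightarrow> x \<in> M \<Longrightarrow> norm (A x) \<le> c * norm x \<and> x - A x \<in> \<theta> M"
      by blast
    \<comment> \<open>Adjoining \<open>{0}\<close> keeps the union \<open>H\<close> in the chain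
      even when \<open>G\<close> is the only member; the extension then starts from the zero
      space.\<close>
    define F' where "F' = insert {0} (F - {G})"
    have F'\<M>: "F' \<subseteq> \<M>" using psubset.prems zero by (auto simp: F'_def)
    define H where "H = \<Union>F'"
    have F'_chain: "X \<subseteq> Y \<or> Y \<subseteq> X" if "X \<in> F'" "Y \<in> F'" for X Y
      using chain that F'\<M> by blast
    have "finite F'" "F' \<noteq> {}" using psubset.hyps by (simp_all add: F'_def)
    then have "H \<in> F'"
      unfolding H_def by (rule finite_subset_chain_Union_mem[OF _ _ F'_chain])
    then have H: "H \<in> \<M>" using F'\<M> by blast
    have G: "G \<in> \<M>" using GF psubset.prems by blast
    have "0 \<in> G" using closed_csubspaceD(2)[OF sub(1)[OF G]] .
    then have HG: "H \<subseteq> G" by (auto simp: H_def F'_def G_def)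
    have A_H: "norm (A x) \<le> c * norm x \<and> x - A x \<in> \<theta> H" if "x \<in> H" for x
    proof (cases "H \<in> F - {G}")
      case False
      then have "x = 0" using \<open>H \<in> F'\<close> that by (auto simp: F'_def)
      then show ?thesis
        using A closed_csubspaceD(2)[OF sub(2)[OF H]] by (simp add: clinear_zero)
    qed (use A_F that in blast)
    \<comment> \<open>Monotonicity of \<open>\<theta>\<close> makes the values already fixed on
      \<open>H\<close> compatible with the constraint for \<open>G\<close>.\<close>
    have A_G: "x - A x \<in> \<theta> G" if "x \<in> H" for x
      using A_H[OF that] monotone_onD[OF mono H G HG] by blast
    obtain B where B: "clinear B" "\<And>x. x \<in> H \<Longrightarrow> B x = A x"
      "\<And>x. x \<in> G \<Longrightarrow> norm (B x) \<le> c * norm x" "\<And>x. x \<in> G \<Longrightarrow> x - B x \<in> \<theta> G"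
      using contraction_completion_step[OF sub(1)[OF H] sub(1)[OF G] sub(2)[OF G] HG A g
          near[OF G] _ A_G] A_H by blast
    have "norm (B x) \<le> c * norm x \<and> x - B x \<in> \<theta> M" if "M \<in> F" "x \<in> M" for M x
    proof (cases "M = G")
      case False
      then have "x \<in> H" using that by (auto simp: H_def F'_def)
      then show ?thesis using A_F[of M x] B(2) that False by simp
    qed (use B that in blast)
    then show ?thesis using B(1) by blast
  qed
qed

lemma chain_completion:
  assumes univ: "UNIV \<in> \<M>"
  obtains A where "clinear A" "\<And>x. norm (A x) \<le> c * norm x"
    "\<And>M x. M \<in> \<M> \<Longrightarrow> x \<in> M \<Longrightarrow> x - A x \<in> \<theta> M"
proof -
  text \<open>
    Operators are encoded as sesquilinear forms, for which weak operator compactness is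
    Tychonoff's theorem.
  \<close>
  define K :: "('a \<times> 'a \<Rightarrow> complex) set"
    where "K = (\<Pi>\<^sub>E (x, y)\<in>UNIV. cball 0 (c * norm x * norm y))"
  define L :: "('a \<times> 'a \<Rightarrow> complex) set"
    where "L = {b. (\<forall>x x' y. b (x + x', y) = b (x, y) + b (x', y)) \<and>
      (\<forall>a x y. b (a *\<^sub>C x, y) = a * b (x, y)) \<and>
      (\<forall>x y y'. b (x, y + y') = b (x, y) + b (x, y')) \<and>
      (\<forall>a x y. b (x, a *\<^sub>C y) = cnj a * b (x, y))}"
  \<comment> \<open>The constraint for \<open>M\<close>, tested against the orthogonal complement of
    \<open>\<theta> M\<close>: each condition fixes one coordinate of \<open>b\<close>, so
    \<open>C M\<close> is closed in the product topology.\<close>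
  define C :: "'a set \<Rightarrow> ('a \<times> 'a \<Rightarrow> complex) set"
    where "C M = (\<Inter>x\<in>M. \<Inter>y\<in>{y. \<forall>z\<in>\<theta> M. cinner y z = 0}. {b. b (x, y) = cinner x y})" for M
  have "compactin euclidean K"
    unfolding K_def euclidean_product_topology[symmetric] compactin_PiE by auto
  moreover have "closed L"
    unfolding L_def
    by (intro closed_Collect_conj closed_Collect_all closed_Collect_eq continuous_intros
        continuous_on_product_coordinates)
  ultimately have "compact (K \<inter> L)"
    by (simp add: compact_Int_closed)
  moreover have "closed (C M)" for M
    unfolding C_def
    by (intro closed_INT ballI closed_Collect_eq continuous_on_const
        continuous_on_product_coordinates)
  moreover have "K \<inter> L \<inter> (\<Inter>M\<in>F. C M) \<noteq> {}" if F: "finite F" "F \<subseteq> \<M>" for F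
  proof -
    \<comment> \<open>Including \<open>UNIV\<close> makes the norm bound hold on the whole
      space.\<close>
    have "finite (insert UNIV F)" "insert UNIV F \<subseteq> \<M>" using F univ by auto
    from finite_chain_completion[OF this] obtain A where A: "clinear A"
      and A_F: "\<And>M x. M \<in> insert UNIV F \<Longrightarrow> x \<in> M
        \<Longrightarrow> norm (A x) \<le> c * norm x \<and> x - A x \<in> \<theta> M"
      by blast
    have A_le: "norm (A x) \<le> c * norm x" for x
      using A_F[of UNIV x] by simp
    define b where "b = (\<lambda>(x, y). cinner (A x) y)"
    have "cmod (cinner (A x) y) \<le> c * norm x * norm y" for x y
      using norm_cinner_le[of "A x" y] mult_right_mono[OF A_le[of x], of "norm y"] by simp
    then have "b \<in> K" by (simp add: K_def b_def PiE_def Pi_def)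
    moreover have "b \<in> L"
      using A by (simp add: L_def b_def clinear_add clinear_scaleC cinner_add_left
          cinner_add_right cinner_scaleC_left cinner_scaleC_right)
    moreover have "b \<in> C M" if "M \<in> F" for M
    proof -
      have "cinner (A x) y = cinner x y" if "x \<in> M" "\<forall>z\<in>\<theta> M. cinner y z = 0" for x y
      proof -
        have "cinner (x - A x) y = 0"
          using A_F[OF insertI2[OF \<open>M \<in> F\<close>] that(1)] that(2) cinner_eq_zero_sym by blast
        then show ?thesis by (simp add: cinner_diff_left)
      qed
      then show ?thesis by (simp add: C_def b_def)
    qed
    ultimately show ?thesis by blast
  qed
  ultimately have "K \<inter> L \<inter> (\<Inter>M\<in>\<M>. C M) \<noteq> {}"
    by (rule compact_imp_fip_image)
  then obtain b where bK: "b \<in> K" and bL: "b \<in> L" and bC: "\<And>M. M \<in> \<M> \<Longrightarrow> b \<in> C M"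
    by blast
  have b_le: "cmod (b (x, y)) \<le> c * norm x * norm y" for x y
    using bK by (fastforce simp: K_def PiE_def Pi_def)
  \<comment> \<open>Conjugation makes the form linear in \<open>y\<close>, so the Riesz
    representation recovers \<open>A x\<close> from the limiting form.\<close>
  have "\<exists>a. \<forall>y. cnj (b (x, y)) = cinner y a" for x
    using bL b_le[of x]
    by (intro clinear_functional_riesz[where K = "c * norm x"]) (auto simp: L_def)
  then obtain A where "\<And>x y. cnj (b (x, y)) = cinner y (A x)" by metis
  then have A: "cinner (A x) y = b (x, y)" for x y
    by (metis cinner_commute complex_cnj_cnj)
  have A_eqI: "A x = w" if "\<And>y. cinner w y = b (x, y)" for x w
  proof -
    have "cinner (A x - w) (A x - w) = 0" by (simp add: cinner_diff_left A that)
    then show ?thesis by (simp add: cinner_self_eq_zero)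
  qed
  have "clinear A"
    using bL by (intro clinearI A_eqI) (simp_all add: cinner_add_left cinner_scaleC_left A L_def)
  moreover have "norm (A x) \<le> c * norm x" for x
  proof -
    have "norm (A x) * norm (A x) = cmod (b (x, A x))"
      by (simp add: cinner_self power2_eq_square norm_mult flip: A)
    also have "\<dots> \<le> norm (A x) * (c * norm x)"
      using b_le[of x "A x"] by (simp add: mult_ac)
    finally show ?thesis
      using g by (cases "A x = 0") auto
  qed
  moreover have "x - A x \<in> \<theta> M" if "M \<in> \<M>" "x \<in> M" for M x
  proof (rule mem_if_orthogonal_to_complement[OF sub(2)[OF that(1)]])
    fix y assume "\<And>z. z \<in> \<theta> M \<Longrightarrow> cinner y z = 0"
    then show "cinner (x - A x) y = 0"
      using bC[OF that(1)] that(2) by (simp add: C_def cinner_diff_left A)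
  qed
  ultimately show thesis by (rule that)
qed

end

section \<open>Perturbations of the identity\<close>

text \<open>The resolvent on the whole space is a right inverse of \<open>I - A\<close>; as
  \<open>I - A\<close> is injective, it is also a left inverse.\<close>

lemma invertible_op_diff_contraction:
  fixes A :: "'a::complex_hilbert \<Rightarrow> 'a"
  assumes A: "clinear A" and A_le: "\<And>x. norm (A x) \<le> c * norm x" and c: "0 \<le> c" "c < 1"
  shows "invertible_op (\<lambda>x. x - A x)"
proof -
  have univ: "closed_csubspace (UNIV :: 'a set)"
    by (simp add: closed_csubspace_def)
  obtain R where R: "clinear R" and R_eq: "\<And>e. R e = e + A (R e)"
    using contraction_resolvent[OF univ A clinear_ident _ _ c A_le] by blast
  have inj: "x = y" if "x - A x = y - A y" for x y
  proof -
    have "x - y = A (x - y)" using that A by (simp add: clinear_diff algebra_simps)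
    then have "norm (x - y) \<le> c * norm (x - y)" using A_le by metis
    then have "(1 - c) * norm (x - y) \<le> 0" by (simp add: algebra_simps)
    then show ?thesis using c by (simp add: mult_le_0_iff)
  qed
  have SR: "R e - A (R e) = e" for e using R_eq[of e] by (simp add: algebra_simps)
  have "bounded_clinear (\<lambda>x. x - A x)"
  proof (rule bounded_clinearI)
    show "clinear (\<lambda>x. x - A x)" by (intro clinear_diff_fun clinear_ident A)
    show "norm (x - A x) \<le> (1 + c) * norm x" for x
      using norm_triangle_ineq4[of x "A x"] A_le[of x] by (simp add: algebra_simps)
  qed
  moreover have "bounded_clinear R"
  proof (rule bounded_clinearI[OF R])
    fix e
    have "norm (R e) \<le> norm e + c * norm (R e)"
      using norm_triangle_ineq[of e "A (R e)"] A_le[of "R e"] by (simp flip: R_eq)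
    then show "norm (R e) \<le> (1 / (1 - c)) * norm e"
      using c by (simp add: field_simps)
  qed
  moreover have "R \<circ> (\<lambda>x. x - A x) = id"
    by (rule ext) (simp add: inj SR)
  moreover have "(\<lambda>x. x - A x) \<circ> R = id"
    by (rule ext) (simp add: SR)
  ultimately show ?thesis unfolding invertible_op_def by blast
qed

lemma image_diff_contraction_eq:
  fixes A :: "'a::complex_hilbert \<Rightarrow> 'a"
  assumes M: "closed_csubspace M" and K: "closed_csubspace K" and A: "clinear A"
    and A_le: "\<And>x. norm (A x) \<le> c * norm x" and c: "0 \<le> c" "c < 1"
    and near: "\<And>x. norm (ortho_proj K x - ortho_proj M x) \<le> c * norm x"
    and sub: "\<And>x. x \<in> M \<Longrightarrow> x - A x \<in> K"
  shows "(\<lambda>x. x - A x) ` M = K"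
proof
  show "K \<subseteq> (\<lambda>x. x - A x) ` M"
  proof
    fix x assume x: "x \<in> K"
    define P where "P = ortho_proj M"
    have P: "clinear P" unfolding P_def by (rule clinear_ortho_proj[OF M])
    have PM: "P y \<in> M" for y unfolding P_def by (rule ortho_proj_mem[OF M])
    have "norm (P (A y)) \<le> c * norm y" for y
      unfolding P_def using norm_ortho_proj_le[OF M, of "A y"] A_le[of y] by linarith
    \<comment> \<open>Compressing \<open>I - A\<close> to \<open>M\<close> gives
      \<open>I - P A\<close>, invertible there; \<open>m = R x\<close> is the vector of
      \<open>M\<close> with \<open>P (m - A m) = P x\<close>.\<close>
    then obtain R where R: "\<And>e. R e \<in> M" "\<And>e. R e = P e + P (A (R e))"
      using contraction_resolvent[OF M clinear_compose[OF P A] P PM PM c] by blast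
    define m where "m = R x"
    have m: "m \<in> M" "m = P x + P (A m)" unfolding m_def by (rule R)+
    \<comment> \<open>The defect \<open>z\<close> lies in \<open>K\<close> and is annihilated by
      \<open>P\<close>, so \<open>near\<close> gives \<open>norm z \<le> c * norm z\<close> and
      forces \<open>z = 0\<close>.\<close>
    define z where "z = x - (m - A m)"
    have "z \<in> K" unfolding z_def using closed_csubspaceD(4)[OF K x sub[OF m(1)]] .
    then have "ortho_proj K z = z" using ortho_proj_eq_self_iff[OF K] by blast
    moreover have "P m = m" unfolding P_def using ortho_proj_eq_self_iff[OF M] m(1) by blast
    then have "P x = P m - P (A m)" using m(2) by (metis add_diff_cancel_right')
    then have "P z = 0" using P by (simp add: z_def clinear_diff)
    ultimately have "norm z \<le> c * norm z" using near[of z] by (simp add: P_def)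
    then have "(1 - c) * norm z \<le> 0" by (simp add: algebra_simps)
    then have "z = 0" using c by (simp add: mult_le_0_iff)
    then show "x \<in> (\<lambda>x. x - A x) ` M" using m(1) by (auto simp: z_def)
  qed
qed (use sub in blast)

section \<open>Pointwise estimates from the supremum, and the similarity of the nests\<close>

lemma norm_diff_ortho_proj_le_nest_map_dist:
  fixes \<M> :: "'a::complex_hilbert set set"
  assumes sub: "\<And>M. M \<in> \<M> \<Longrightarrow> closed_csubspace M"
      "\<And>M. M \<in> \<M> \<Longrightarrow> closed_csubspace (\<theta> M)"
    and M: "M \<in> \<M>"
  shows "norm (ortho_proj (\<theta> M) x - ortho_proj M x) \<le> nest_map_dist \<M> \<theta> * norm x"
    and "0 \<le> nest_map_dist \<M> \<theta>"
proof -
  define D where "D M = (\<lambda>x. ortho_proj (\<theta> M) x - ortho_proj M x)" for M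
  \<comment> \<open>The crude constant 2 guarantees that the operator norms are finite and that the
    real supremum is over a bounded set.\<close>
  have D_le: "norm (D M x) \<le> 2 * norm x" if "M \<in> \<M>" for M x
    unfolding D_def
    using norm_triangle_ineq4[of "ortho_proj (\<theta> M) x" "ortho_proj M x"]
      norm_ortho_proj_le[OF sub(1)[OF that], of x] norm_ortho_proj_le[OF sub(2)[OF that], of x]
    by linarith
  have "linear (D M)"
    unfolding D_def
    by (intro clinear_imp_linear clinear_diff_fun clinear_ortho_proj sub M)
  then have "bounded_linear (D M)"
    using D_le[OF M]
    by (intro bounded_linear_intro[where K = 2]) (auto simp: linear_add linear_scale mult.commute)
  then have D: "norm (D M x) \<le> onorm (D M) * norm x" "0 \<le> onorm (D M)"
    by (rule onorm, rule onorm_pos_le)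
  have le: "onorm (D M) \<le> nest_map_dist \<M> \<theta>"
    unfolding nest_map_dist_def D_def[symmetric]
    by (intro cSUP_upper M bdd_aboveI2[where M = 2] onorm_bound D_le) simp_all
  then show "0 \<le> nest_map_dist \<M> \<theta>" using D(2) by linarith
  show "norm (ortho_proj (\<theta> M) x - ortho_proj M x) \<le> nest_map_dist \<M> \<theta> * norm x"
    using D(1) mult_right_mono[OF le norm_ge_zero[of x]] unfolding D_def by linarith
qed

theorem corollary3p2:
  fixes \<M> \<N> :: "'a::complex_hilbert set set"
    and \<theta> :: "'a set \<Rightarrow> 'a set"
    and \<gamma> :: real
  assumes "separable_space (euclidean :: 'a topology)"
    and "nest \<M>" and "nest \<N>"
    and "nest_order_iso \<theta> \<M> \<N>"
    and "nest_map_dist \<M> \<theta> = \<gamma>" and "\<gamma> < 1"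
  shows "(\<exists>S. invertible_op S \<and> (\<forall>M\<in>\<M>. S ` M = \<theta> M)) \<and>
    (\<gamma> < 1 / 2 \<longrightarrow>
      (\<exists>S. invertible_op S \<and> (\<forall>M\<in>\<M>. S ` M = \<theta> M) \<and>
        onorm (\<lambda>x. S x - x) \<le> 2 * \<gamma>)) \<and>
    (\<gamma> \<ge> 1 / 2 \<longrightarrow>
      (\<forall>\<epsilon>>0. \<exists>S. invertible_op S \<and> (\<forall>M\<in>\<M>. S ` M = \<theta> M) \<and>
        onorm (\<lambda>x. S x - x) < 2 + \<epsilon>))"
proof -
  have chain: "M \<subseteq> N \<or> N \<subseteq> M" if "M \<in> \<M>" "N \<in> \<M>" for M N
    using assms(2) that by (auto simp: nest_def)
  have zero: "{0} \<in> \<M>" and univ: "UNIV \<in> \<M>" and mono: "mono_on \<M> \<theta>"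
    using assms(2,4) by (auto simp: nest_def nest_order_iso_def)
  have sub: "closed_csubspace M" "closed_csubspace (\<theta> M)" if "M \<in> \<M>" for M
    using assms(2-4) that by (auto simp: nest_def nest_order_iso_def dest: bij_betwE)
  have near: "norm (ortho_proj (\<theta> M) x - ortho_proj M x) \<le> \<gamma> * norm x" if "M \<in> \<M>" for M x
    using norm_diff_ortho_proj_le_nest_map_dist(1)[of \<M> \<theta> M x, OF sub that] assms(5) by simp
  \<comment> \<open>On \<open>M\<close> the projection onto \<open>M\<close> is the identity, so
    this is the bound on the compression that the completion argument requires.\<close>
  have near': "norm (x - ortho_proj (\<theta> M) x) \<le> \<gamma> * norm x" if "M \<in> \<M>" "x \<in> M" for M x
    using near[OF that(1), of x] ortho_proj_eq_self_iff[OF sub(1)[OF that(1)], of x] that(2)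
    by (simp add: norm_minus_commute)
  have nonneg: "0 \<le> \<gamma>"
    using norm_diff_ortho_proj_le_nest_map_dist(2)[of \<M> \<theta>, OF sub zero] assms(5) by simp
  text \<open>If \<open>\<gamma> = 0\<close> there is no room for \<open>\<gamma> < c \<le> 2 \<gamma>\<close>, so this case is treated separately.\<close>
  define c where "c = min (2 * \<gamma>) ((1 + \<gamma>) / 2)"
  have c1: "c < 1" using assms(6) by (simp add: c_def min_less_iff_disj)
  \<comment> \<open>One \<open>S\<close> serves all three claims:
    \<open>c \<le> 2 * \<gamma>\<close> gives the first norm bound, while
    \<open>c \<le> (1 + \<gamma>) / 2 < 1\<close> gives invertibility and lies below
    \<open>2 + \<epsilon>\<close>. For \<open>\<gamma> > 0\<close> both terms of the minimum exceed
    \<open>\<gamma>\<close>, as the strict gap in the completion demands.\<close>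
  have "\<exists>S. invertible_op S \<and> (\<forall>M\<in>\<M>. S ` M = \<theta> M) \<and> onorm (\<lambda>x. S x - x) \<le> c"
  proof (cases "\<gamma> = 0")
    case True
    have "\<theta> M = M" if "M \<in> \<M>" for M
    proof -
      have "ortho_proj (\<theta> M) x = ortho_proj M x" for x
        using near[OF that, of x] True by simp
      \<comment> \<open>A closed subspace is the fixed-point set of its projection, so equal
        projections have equal ranges.\<close>
      then show ?thesis
        by (simp add: set_eq_iff flip: ortho_proj_eq_self_iff[OF sub(1)[OF that]]
            ortho_proj_eq_self_iff[OF sub(2)[OF that]])
    qed
    moreover have "invertible_op (\<lambda>x :: 'a. x)"
      using invertible_op_diff_contraction[of "\<lambda>x :: 'a. 0" 0] by (simp add: clinearI)
    ultimately show ?thesis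
      using True by (intro exI[of _ "\<lambda>x. x"]) (simp add: onorm_zero c_def)
  next
    case False
    then have c: "\<gamma> < c" using nonneg assms(6) by (simp add: c_def)
    then have "0 \<le> c" and le: "\<gamma> * norm x \<le> c * norm x" for x :: 'a
      using nonneg by (simp_all add: mult_right_mono)
    obtain A where A: "clinear A" and A_le: "\<And>x. norm (A x) \<le> c * norm x"
      and A_\<theta>: "\<And>M x. M \<in> \<M> \<Longrightarrow> x \<in> M \<Longrightarrow> x - A x \<in> \<theta> M"
      using chain_completion[OF sub chain zero mono nonneg c near' univ] by metis
    have "(\<lambda>x. x - A x) ` M = \<theta> M" if "M \<in> \<M>" for M
      using image_diff_contraction_eq[OF sub[OF that] A A_le \<open>0 \<le> c\<close> c1
          order_trans[OF near[OF that] le] A_\<theta>[OF that]] .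
    moreover have "onorm (\<lambda>x. (x - A x) - x) \<le> c"
      using A_le \<open>0 \<le> c\<close> by (intro onorm_bound) simp_all
    ultimately show ?thesis
      using invertible_op_diff_contraction[OF A A_le \<open>0 \<le> c\<close> c1] by blast
  qed
  then obtain S where S: "invertible_op S" "\<forall>M\<in>\<M>. S ` M = \<theta> M"
    and S_le: "onorm (\<lambda>x. S x - x) \<le> c"
    by blast
  have "onorm (\<lambda>x. S x - x) \<le> 2 * \<gamma>" using S_le by (simp add: c_def)
  moreover have "onorm (\<lambda>x. S x - x) < 2 + \<epsilon>" if "\<epsilon> > 0" for \<epsilon>
    using S_le c1 that by linarith
  ultimately show ?thesis using S by blast
qed

end
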